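(* Consider, for $\varepsilon>0$, the amplitude system $$A_{t}=aA_{xx}+bA+c|A|^2A+dAB,\qquad B_{t}=\varepsilon^{-1}\big(fB_{x}+h(|A|^2)_{x}\big)+e_BB_{xx}+\big(\Re(gA\bar A_{x})\big)_{x},$$ $A\in\mathbb C$, $B\in\mathbb R^m$, with a periodic solution $(A_0e^{i(\kappa x-\omega t)},B_0)$ (as in the context), and its Darcy reduction $$A_t=aA_{xx}+\hat bA+\hat c|A|^2A,\qquad \hat b=b+d(B_0+f^{-1}hA_0^2),\quad \hat c=c-df^{-1}h,$$ with periodic solution $A_0e^{i(\kappa x-\omega t)}$. Assume $\det f\ne0$, $\Re(\hat c)\neq0$, and that $\kappa^2$ does not lie on the Eckhaus stability boundary of the Darcy reduction, i.e. $\mu_{D,t}\ne0$, where, with $\hat q=-\Im(\hat c)/\Re(\hat c)$, $$\mu_{D,t}=-\frac{2\kappa^2\Re(a)^2(1+\hat q^2)+A_0^2\big(\Re(a)\Re(\hat c)+\Im(a)\Im(\hat c)\big)}{A_0^2\Re(\hat c)}.$$ Then for $\varepsilon>0$ sufficiently small, spectral stability of $A_0e^{i(\kappa x-\omega t)}$ as a solution of the Darcy reduction is necessary for spectral stability of $(A_0e^{i(\kappa x-\omega t)},B_0)$ as a solution of the full amplitude system.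
   Context: Parameters: $a,b,c\in\mathbb C$, $d\in\mathbb C^{1\times m}$, $g\in\mathbb C^{m\times1}$, $h\in\mathbb R^{m\times1}$, $f,e_B\in\mathbb R^{m\times m}$, $\Re a>0$, $\Re b>0$, $\Re c<0$, $\operatorname{spec}f\subset\mathbb R$, $\Re\operatorname{spec}(e_B)>0$, $\Re\operatorname{spec}(izf-z^2e_B)<0$ for real $z\ne0$; $B_0\in\mathbb R^m$, $\tilde b=b+dB_0$, $\kappa^2<\Re(\tilde b)/\Re(a)$, $A_0>0$ with $A_0^2=(\Re\tilde b-\kappa^2\Re a)/(-\Re c)$. Linearizing the full system via $A=(A_0+u+iv)e^{i(\kappa x-\omega t)}$, $B=B_0+w$ gives the constant-coefficient Fourier symbol ($\sigma\in\mathbb R$) $$M(\varepsilon,\sigma)=\begin{pmatrix}2A_0^2\Re c&0&A_0\Re d\\ 2A_0^2\Im c&0&A_0\Im d\\ 0&0&0\end{pmatrix}+i\sigma\begin{pmatrix}-2\kappa\Im a&-2\kappa\Re a&0\\ 2\kappa\Re a&-2\kappa\Im a&0\\ 2A_0h\varepsilon^{-1}+2A_0\kappa\Im g&0&\varepsilon^{-1}f\end{pmatrix}-\sigma^2\begin{pmatrix}\Re a&-\Im a&0\\ \Im a&\Re a&0\\ A_0\Re g&A_0\Im g&e_B\end{pmatrix},$$ and linearizing the Darcy reduction in the same way gives $$D(\sigma)=\begin{pmatrix}2A_0^2\Re\hat c&0\\ 2A_0^2\Im\hat c&0\end{pmatrix}+i\sigma\begin{pmatrix}-2\kappa\Im a&-2\kappa\Re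 a\\ 2\kappa\Re a&-2\kappa\Im a\end{pmatrix}-\sigma^2\begin{pmatrix}\Re a&-\Im a\\ \Im a&\Re a\end{pmatrix}.$$ Spectral stability means that all eigenvalues of the symbol ($M(\varepsilon,\sigma)$, respectively $D(\sigma)$) have real part $\le0$ for all $\sigma\in\mathbb R$. *)

theory Defs
  imports "HOL-Analysis.Analysis"
begin

definition mat_spectrum :: "complex^'n^'n \<Rightarrow> complex set" where
  "mat_spectrum M = {z. \<exists>v. v \<noteq> 0 \<and> M *v v = z *s v}"

(* The product d B of a complex row vector and a real column vector. *)
definition row_times :: "complex^'m \<Rightarrow> real^'m \<Rightarrow> complex" where
  "row_times d B = (\<Sum>j\<in>UNIV. d $ j * complex_of_real (B $ j))"

definition x_deriv :: "(real \<Rightarrow> real \<Rightarrow> 'v::real_normed_vector) \<Rightarrow> (real \<Rightarrow> real \<Rightarrow> 'v) \<Rightarrow> bool" where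
  "x_deriv F F' \<longleftrightarrow> (\<forall>x t. ((\<lambda>y. F y t) has_vector_derivative F' x t) (at x))"

definition t_deriv :: "(real \<Rightarrow> real \<Rightarrow> 'v::real_normed_vector) \<Rightarrow> (real \<Rightarrow> real \<Rightarrow> 'v) \<Rightarrow> bool" where
  "t_deriv F F' \<longleftrightarrow> (\<forall>x t. ((\<lambda>s. F x s) has_vector_derivative F' x t) (at t))"

(* Classical solutions; fields are functions of (x, t) in this order.
   Nx stands for (|A|^2)_x and Gx for (Re (g A cnj(A_x)))_x. *)
definition amplitude_solution ::
  "complex \<Rightarrow> complex \<Rightarrow> complex \<Rightarrow> complex^'m \<Rightarrow> complex^'m \<Rightarrow> real^'m \<Rightarrow> real^'m^'m \<Rightarrow> real^'m^'m \<Rightarrow> real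
   \<Rightarrow> (real \<Rightarrow> real \<Rightarrow> complex) \<Rightarrow> (real \<Rightarrow> real \<Rightarrow> real^'m) \<Rightarrow> bool" where
  "amplitude_solution a b c d g h f e\<^sub>B \<epsilon> A B \<longleftrightarrow>
    (\<exists>At Ax Axx Bt Bx Bxx Nx Gx.
       t_deriv A At \<and> x_deriv A Ax \<and> x_deriv Ax Axx \<and>
       t_deriv B Bt \<and> x_deriv B Bx \<and> x_deriv Bx Bxx \<and>
       x_deriv (\<lambda>x t. (cmod (A x t))\<^sup>2) Nx \<and>
       x_deriv (\<lambda>x t. \<chi> j. Re (g $ j * A x t * cnj (Ax x t))) Gx \<and>
       (\<forall>x t.
          At x t = a * Axx x t + b * A x t + c * complex_of_real ((cmod (A x t))\<^sup>2) * A x t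
                   + A x t * row_times d (B x t) \<and>
          Bt x t = (1 / \<epsilon>) *\<^sub>R (f *v Bx x t + Nx x t *\<^sub>R h) + e\<^sub>B *v Bxx x t + Gx x t))"

definition darcy_solution ::
  "complex \<Rightarrow> complex \<Rightarrow> complex \<Rightarrow> (real \<Rightarrow> real \<Rightarrow> complex) \<Rightarrow> bool" where
  "darcy_solution a b' c' A \<longleftrightarrow>
    (\<exists>At Ax Axx. t_deriv A At \<and> x_deriv A Ax \<and> x_deriv Ax Axx \<and>
       (\<forall>x t. At x t = a * Axx x t + b' * A x t + c' * complex_of_real ((cmod (A x t))\<^sup>2) * A x t))"

definition plane_wave :: "real \<Rightarrow> real \<Rightarrow> real \<Rightarrow> real \<Rightarrow> real \<Rightarrow> complex" where
  "plane_wave A\<^sub>0 \<kappa> \<omega> x t = complex_of_real A\<^sub>0 * exp (\<i> * complex_of_real (\<kappa> * x - \<omega> * t))"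

(* Symbol of the real operator  X + Y d/dx + Z d^2/dx^2  at frequency \<sigma>. *)
definition fourier_symbol ::
  "real^'n^'n \<Rightarrow> real^'n^'n \<Rightarrow> real^'n^'n \<Rightarrow> real \<Rightarrow> complex^'n^'n" where
  "fourier_symbol X Y Z \<sigma> = (\<chi> i j.
     complex_of_real (X $ i $ j) + \<i> * complex_of_real (\<sigma> * Y $ i $ j)
       - complex_of_real (\<sigma>\<^sup>2 * Z $ i $ j))"

definition mat22 :: "real \<Rightarrow> real \<Rightarrow> real \<Rightarrow> real \<Rightarrow> real^2^2" where
  "mat22 p q r s = vector [vector [p, q], vector [r, s]]"

(* The block matrix ((P, Q), (R, S)). The type real^'k^'l has 'l rows and 'k columns. *)
definition block_matrix ::
  "real^'k^'k \<Rightarrow> real^'m^'k \<Rightarrow> real^'k^'m \<Rightarrow> real^'m^'m \<Rightarrow> real^('k + 'm)^('k + 'm)" where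
  "block_matrix P Q R S = (\<chi> i j.
     case i of
       Inl i' \<Rightarrow> (case j of Inl j' \<Rightarrow> P $ i' $ j' | Inr j' \<Rightarrow> Q $ i' $ j')
     | Inr i' \<Rightarrow> (case j of Inl j' \<Rightarrow> R $ i' $ j' | Inr j' \<Rightarrow> S $ i' $ j'))"

(* Symbol of the linearization in the variables (u, v, w), where
   A = (A0 + u + i v) exp(i(\<kappa> x - \<omega> t)) and B = B0 + w. *)
definition full_symbol ::
  "complex \<Rightarrow> complex \<Rightarrow> complex^'m \<Rightarrow> complex^'m \<Rightarrow> real^'m \<Rightarrow> real^'m^'m \<Rightarrow> real^'m^'m
   \<Rightarrow> real \<Rightarrow> real \<Rightarrow> real \<Rightarrow> real \<Rightarrow> complex^(2 + 'm)^(2 + 'm)" where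
  "full_symbol a c d g h f e\<^sub>B \<kappa> A\<^sub>0 \<epsilon> \<sigma> = fourier_symbol
     (block_matrix
        (mat22 (2 * A\<^sub>0\<^sup>2 * Re c) 0
               (2 * A\<^sub>0\<^sup>2 * Im c) 0)
        (vector [\<chi> j. A\<^sub>0 * Re (d $ j), \<chi> j. A\<^sub>0 * Im (d $ j)])
        0
        0)
     (block_matrix
        (mat22 (- 2 * \<kappa> * Im a) (- 2 * \<kappa> * Re a)
               (2 * \<kappa> * Re a)   (- 2 * \<kappa> * Im a))
        0
        (\<chi> k. vector [2 * A\<^sub>0 * (h $ k) / \<epsilon> + 2 * A\<^sub>0 * \<kappa> * Im (g $ k), 0])
        ((1 / \<epsilon>) *\<^sub>R f))
     (block_matrix
        (mat22 (Re a) (- Im a)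
               (Im a) (Re a))
        0
        (\<chi> k. vector [A\<^sub>0 * Re (g $ k), A\<^sub>0 * Im (g $ k)])
        e\<^sub>B)
     \<sigma>"

definition darcy_symbol ::
  "complex \<Rightarrow> complex \<Rightarrow> real \<Rightarrow> real \<Rightarrow> real \<Rightarrow> complex^2^2" where
  "darcy_symbol a c' \<kappa> A\<^sub>0 \<sigma> = fourier_symbol
     (mat22 (2 * A\<^sub>0\<^sup>2 * Re c') 0
            (2 * A\<^sub>0\<^sup>2 * Im c') 0)
     (mat22 (- 2 * \<kappa> * Im a) (- 2 * \<kappa> * Re a)
            (2 * \<kappa> * Re a)   (- 2 * \<kappa> * Im a))
     (mat22 (Re a) (- Im a)
            (Im a) (Re a))
     \<sigma>"

definition spectrally_stable :: "(real \<Rightarrow> complex^'n^'n) \<Rightarrow> bool" where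
  "spectrally_stable M \<longleftrightarrow> (\<forall>\<sigma>. \<forall>z\<in>mat_spectrum (M \<sigma>). Re z \<le> 0)"

end

theory Submission
  imports Defs "HOL-Complex_Analysis.Complex_Analysis"
begin

text \<open>
  At a fixed frequency \<open>\<sigma> \<noteq> 0\<close>, multiply the \<open>B\<close>-rows of the eigenvalue problem for \<open>M(\<epsilon>,\<sigma>)\<close>
  by \<open>\<epsilon>\<close>. The resulting generalized eigenvalue problem extends continuously to \<open>\<epsilon> = 0\<close>, where the
  \<open>B\<close>-rows become \<open>\<i>\<sigma>(f w + 2 A\<^sub>0 u\<^sub>1 h) = 0\<close>; eliminating \<open>w\<close> leaves exactly the eigenvalue problem
  of \<open>D(\<sigma>)\<close>. By Hurwitz' theorem an unstable eigenvalue of \<open>D(\<sigma>)\<close> therefore persists for small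
  \<open>\<epsilon> > 0\<close>. An instability of \<open>D\<close> at \<open>\<sigma> = 0\<close> is first moved to a nonzero frequency by the same
  argument.
\<close>

section \<open>Persistence of zeros and of generalized eigenvalues under perturbation\<close>

text \<open>If zeros were absent along some sequence of parameters tending to 0, the zero-free
  functions would converge locally uniformly to \<open>F 0\<close>, and Hurwitz' theorem would make
  \<open>F 0\<close> zero-free or constant. The points \<open>z0\<close> and \<open>z1\<close>
  exclude both.\<close>

lemma zero_persists:
  fixes F :: "real \<Rightarrow> complex \<Rightarrow> complex"
  assumes cont: "continuous_on UNIV (\<lambda>(t, z). F t z)"
    and hol: "\<And>t. F t holomorphic_on S"
    and S: "open S" "connected S"
    and z0: "z0 \<in> S" "F 0 z0 = 0"
    and z1: "z1 \<in> S" "F 0 z1 \<noteq> 0"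
  shows "\<forall>\<^sub>F t in at 0. \<exists>z\<in>S. F t z = 0"
proof (rule ccontr)
  assume "\<not> ?thesis"
  then have "\<exists>t. dist t 0 < 1 / real (Suc n) \<and> (\<forall>z\<in>S. F t z \<noteq> 0)" for n
    unfolding eventually_at by (metis UNIV_I of_nat_0_less_iff zero_less_Suc zero_less_divide_1_iff)
  then obtain T where T: "dist (T n) 0 < 1 / real (Suc n)" "\<And>z. z \<in> S \<Longrightarrow> F (T n) z \<noteq> 0" for n
    by metis
  have T0: "T \<longlonglongrightarrow> 0"
    unfolding tendsto_iff
  proof (intro allI impI)
    fix e :: real assume "e > 0"
    then have "\<forall>\<^sub>F n in sequentially. 1 / real (Suc n) < e"
      by (rule order_tendstoD(2)[OF LIMSEQ_Suc[OF lim_1_over_n]])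
    then show "\<forall>\<^sub>F n in sequentially. dist (T n) 0 < e"
      by eventually_elim (use T(1) less_trans in blast)
  qed
  have "F 0 z0 \<noteq> 0"
  proof (rule Hurwitz_no_zeros[OF S, of "\<lambda>n. F (T n)" "F 0"])
    fix K assume K: "compact K" "K \<subseteq> S"
    show "uniform_limit K (\<lambda>n. F (T n)) (F 0) sequentially"
      unfolding uniform_limit_iff
    proof (intro allI impI)
      fix e :: real assume "e > 0"
      have "continuous_on (UNIV \<times> K) (\<lambda>(t, z). F t z)"
        using cont continuous_on_subset by blast
      \<comment> \<open>Joint continuity and compactness of \<open>K\<close> make the estimate
        uniform in \<open>z\<close> near parameter 0. The bound is non-strict, so
        \<open>e / 2\<close> leaves room for the strict one.\<close>
      then obtain X0 where X0: "0 \<in> X0" "open X0"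
        "\<forall>t\<in>X0 \<inter> UNIV. \<forall>z\<in>K. dist ((\<lambda>(t, z). F t z) (t, z)) ((\<lambda>(t, z). F t z) (0, z)) \<le> e / 2"
        by (rule continuous_on_prod_compactE[OF _ K(1) UNIV_I, where e = "e / 2"]) (use \<open>e > 0\<close> in auto)
      have "\<forall>\<^sub>F n in sequentially. T n \<in> X0"
        using T0 X0(1,2) topological_tendstoD by blast
      then show "\<forall>\<^sub>F n in sequentially. \<forall>z\<in>K. dist (F (T n) z) (F 0 z) < e"
        by eventually_elim (use X0(3) \<open>e > 0\<close> in force)
    qed
  next
    show "\<not> F 0 constant_on S"
      using z0 z1 unfolding constant_on_def by metis
  qed (use hol T z0 in auto)
  with z0 show False by simp
qed

lemma det_eq_0_iff_kernel:
  fixes A :: "'a::field^'n^'n"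
  shows "det A = 0 \<longleftrightarrow> (\<exists>v. v \<noteq> 0 \<and> A *v v = 0)"
  using invertible_det_nz[of A] invertible_left_inverse[of A] matrix_left_invertible_ker[of A] by blast

text \<open>The determinant of \<open>K t - z L t\<close> is polynomial in \<open>z\<close> with
  coefficients continuous in \<open>t\<close>, so \<open>zero_persists\<close> applies.
  \<open>L 0\<close> may be singular, in which case the degree drops at \<open>t = 0\<close>; the
  point \<open>z1\<close> ensures that the determinant does not vanish identically there.\<close>

lemma generalized_eigenvalue_persists:
  fixes K L :: "real \<Rightarrow> complex^'n^'n"
  assumes K: "continuous_on UNIV K" and L: "continuous_on UNIV L"
    and S: "open S" "connected S"
    and z0: "z0 \<in> S" and v: "v \<noteq> 0" "K 0 *v v = z0 *s (L 0 *v v)"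
    and z1: "z1 \<in> S" "\<And>v. K 0 *v v = z1 *s (L 0 *v v) \<Longrightarrow> v = 0"
  shows "\<forall>\<^sub>F t in at 0. \<exists>z\<in>S. \<exists>v. v \<noteq> 0 \<and> K t *v v = z *s (L t *v v)"
proof -
  define F where "F t z = det (\<chi> i j. K t $ i $ j - z * L t $ i $ j)" for t z
  have kernel: "F t z = 0 \<longleftrightarrow> (\<exists>v. v \<noteq> 0 \<and> K t *v v = z *s (L t *v v))" for t z
  proof -
    have "(\<chi> i j. K t $ i $ j - z * L t $ i $ j) *v v = K t *v v - z *s (L t *v v)" for v
      by (simp add: vec_eq_iff matrix_vector_mult_def left_diff_distrib sum_subtractf
          sum_distrib_left mult.assoc)
    then show ?thesis
      unfolding F_def det_eq_0_iff_kernel by simp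
  qed
  have entry: "continuous_on UNIV (\<lambda>x::real \<times> complex. M (fst x) $ i $ j)"
    if "continuous_on UNIV M" for M :: "real \<Rightarrow> complex^'n^'n" and i j
    by (intro continuous_on_component continuous_on_compose2[OF that] continuous_intros) auto
  have "\<forall>\<^sub>F t in at 0. \<exists>z\<in>S. F t z = 0"
  proof (rule zero_persists[OF _ _ S z0 _ z1(1)])
    show "continuous_on UNIV (\<lambda>(t, z). F t z)"
      unfolding F_def det_def case_prod_beta
      by (auto intro!: continuous_intros entry K L)
    show "F t holomorphic_on S" for t
      unfolding F_def det_def by (auto intro!: holomorphic_intros)
  qed (use z1(2) v kernel in blast)+
  then show ?thesis by (simp add: kernel)
qed

section \<open>Moving an instability to a nonzero frequency\<close>

text \<open>Provides the point \<open>z1\<close> that \<open>generalized_eigenvalue_persists\<close>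
  asks for in the right half plane.\<close>

lemma exists_positive_non_eigenvalue:
  fixes A :: "complex^2^2"
  obtains z where "Re z > 0" "z \<notin> mat_spectrum A"
proof -
  have char_poly: "z \<in> mat_spectrum A \<longleftrightarrow> (A$1$1 - z) * (A$2$2 - z) - A$1$2 * A$2$1 = 0" for z
  proof -
    have "(A - mat z) *v v = A *v v - z *s v" for v
      by (simp add: matrix_vector_mult_diff_rdistrib vec_eq_iff matrix_vector_mult_def mat_def
          forall_2 sum_2 left_diff_distrib)
    then have "z \<in> mat_spectrum A \<longleftrightarrow> det (A - mat z) = 0"
      unfolding mat_spectrum_def det_eq_0_iff_kernel by simp
    then show ?thesis by (simp add: det_2 mat_def)
  qed
  \<comment> \<open>The second difference of a monic quadratic is 2.\<close>
  have "\<not> (1 \<in> mat_spectrum A \<and> 2 \<in> mat_spectrum A \<and> 3 \<in> mat_spectrum A)"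
    unfolding char_poly by (auto simp: algebra_simps) algebra
  then show thesis
    using that[of 1] that[of 2] that[of 3] by auto
qed

lemma open_connected_right_half_plane: "open {z. Re z > 0}" "connected {z. Re z > 0}"
  by (auto intro: open_halfspace_Re_gt convex_connected convex_halfspace_Re_gt)

lemma continuous_on_fourier_symbol: "continuous_on UNIV (fourier_symbol X Y Z)"
  unfolding fourier_symbol_def by (intro continuous_intros)

text \<open>The elimination of \<open>w\<close> divides by the frequency, so frequency 0 has to be
  avoided. Since the symbol is continuous in the frequency, an unstable eigenvalue at 0 persists at
  nearby nonzero frequencies.\<close>

lemma unstable_frequency_nonzero:
  fixes X Y Z :: "real^2^2"
  assumes "\<not> spectrally_stable (fourier_symbol X Y Z)"
  obtains \<sigma> z where "\<sigma> \<noteq> 0" "z \<in> mat_spectrum (fourier_symbol X Y Z \<sigma>)" "Re z > 0"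
proof -
  obtain \<sigma> z where z: "z \<in> mat_spectrum (fourier_symbol X Y Z \<sigma>)" "Re z > 0"
    using assms by (auto simp: spectrally_stable_def not_le)
  show thesis
  proof (cases "\<sigma> = 0")
    case True
    obtain v where v: "v \<noteq> 0" "fourier_symbol X Y Z 0 *v v = z *s v"
      using z True by (auto simp: mat_spectrum_def)
    obtain z1 where z1: "Re z1 > 0" "z1 \<notin> mat_spectrum (fourier_symbol X Y Z 0)"
      by (rule exists_positive_non_eigenvalue)
    \<comment> \<open>With the identity as second matrix, generalized eigenvalues are ordinary
      ones.\<close>
    have "\<forall>\<^sub>F s in at 0. \<exists>z\<in>{z. Re z > 0}. \<exists>v. v \<noteq> 0 \<and>
            fourier_symbol X Y Z s *v v = z *s ((mat 1 :: complex^2^2) *v v)"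
      by (rule generalized_eigenvalue_persists[where ?z0.0 = z and ?z1.0 = z1 and v = v])
        (use z z1 v in \<open>auto simp: continuous_on_fourier_symbol open_connected_right_half_plane
           mat_spectrum_def\<close>)
    moreover have "\<forall>\<^sub>F s in at (0::real). s \<noteq> 0"
      by (simp add: eventually_at_filter)
    ultimately have "\<forall>\<^sub>F s in at 0. s \<noteq> 0 \<and> (\<exists>z. z \<in> mat_spectrum (fourier_symbol X Y Z s) \<and> Re z > 0)"
      by eventually_elim (auto simp: mat_spectrum_def)
    then have "\<exists>s. s \<noteq> 0 \<and> (\<exists>z. z \<in> mat_spectrum (fourier_symbol X Y Z s) \<and> Re z > 0)"
      by (rule eventually_happens'[OF at_neq_bot])
    then show ?thesis using that by blast
  qed (use z that in blast)
qed

section \<open>Elimination of \<open>w\<close> in the singular limit\<close>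

lemma sum_UNIV_Plus:
  fixes F :: "'a::finite + 'b::finite \<Rightarrow> 'c::comm_monoid_add"
  shows "sum F UNIV = (\<Sum>i\<in>UNIV. F (Inl i)) + (\<Sum>j\<in>UNIV. F (Inr j))"
  using sum.Plus[of "UNIV :: 'a set" "UNIV :: 'b set" F] by (simp add: comp_def)

text \<open>The real inverse of \<open>f\<close> also solves the system for complex unknowns. It is
  applied with \<open>s = - (2 * A\<^sub>0 * v $ Inl 1)\<close> to solve the limiting
  \<open>B\<close>-rows for \<open>w\<close>.\<close>

lemma complexified_system_iff:
  fixes f :: "real^'m^'m" and h :: "real^'m" and w :: "complex^'m"
  assumes "det f \<noteq> 0"
  shows "(\<forall>k. (\<Sum>j\<in>UNIV. complex_of_real (f $ k $ j) * w $ j) = s * complex_of_real (h $ k))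
     \<longleftrightarrow> (\<forall>j. w $ j = s * complex_of_real ((matrix_inv f *v h) $ j))"
proof -
  let ?g = "matrix_inv f"
  have "?g ** f = mat 1" "f ** ?g = mat 1"
    using someI_ex[of "\<lambda>B. f ** B = mat 1 \<and> B ** f = mat 1"] assms
    by (auto simp: matrix_inv_def invertible_def simp flip: invertible_det_nz)
  then have gf: "(\<Sum>k\<in>UNIV. ?g $ i $ k * f $ k $ j) = (if i = j then 1 else 0)"
    and fg: "(\<Sum>k\<in>UNIV. f $ i $ k * ?g $ k $ j) = (if i = j then 1 else 0)" for i j
    by (auto simp: matrix_matrix_mult_def mat_def vec_eq_iff)
  \<comment> \<open>Stated for a general pair, since the forward direction cancels \<open>f\<close>
    by its inverse on the left and the backward direction swaps the two.\<close>
  have invert: "(\<Sum>k\<in>UNIV. complex_of_real (A $ i $ k) * (\<Sum>j\<in>UNIV. complex_of_real (B $ k $ j) * y $ j)) = y $ i"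
    if AB: "\<And>i j. (\<Sum>k\<in>UNIV. A $ i $ k * B $ k $ j) = (if i = j then 1 else 0)"
    for A B :: "real^'m^'m" and y :: "complex^'m" and i
  proof -
    have "(\<Sum>k\<in>UNIV. complex_of_real (A $ i $ k) * (\<Sum>j\<in>UNIV. complex_of_real (B $ k $ j) * y $ j))
        = (\<Sum>j\<in>UNIV. \<Sum>k\<in>UNIV. complex_of_real (A $ i $ k) * (complex_of_real (B $ k $ j) * y $ j))"
      unfolding sum_distrib_left by (rule sum.swap)
    also have "\<dots> = (\<Sum>j\<in>UNIV. complex_of_real (\<Sum>k\<in>UNIV. A $ i $ k * B $ k $ j) * y $ j)"
      by (simp add: sum_distrib_right mult.assoc)
    also have "\<dots> = (\<Sum>j\<in>UNIV. if i = j then y $ j else 0)"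
      by (rule sum.cong) (auto simp: AB)
    also have "\<dots> = y $ i"
      by simp
    finally show ?thesis .
  qed
  have rhs: "s * complex_of_real ((?g *v h) $ i)
      = (\<Sum>k\<in>UNIV. complex_of_real (?g $ i $ k) * (s * complex_of_real (h $ k)))" for i
    by (simp add: matrix_vector_mult_def sum_distrib_left mult.left_commute)
  show ?thesis
  proof
    assume "\<forall>k. (\<Sum>j\<in>UNIV. complex_of_real (f $ k $ j) * w $ j) = s * complex_of_real (h $ k)"
    then show "\<forall>j. w $ j = s * complex_of_real ((?g *v h) $ j)"
      using invert[OF gf, of _ w] by (simp add: rhs)
  next
    assume "\<forall>j. w $ j = s * complex_of_real ((?g *v h) $ j)"
    then show "\<forall>k. (\<Sum>j\<in>UNIV. complex_of_real (f $ k $ j) * w $ j) = s * complex_of_real (h $ k)"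
      using invert[OF fg, of _ "\<chi> k. s * complex_of_real (h $ k)"] by (simp add: rhs)
  qed
qed

lemma unstable_darcy_imp_unstable_full:
  fixes d g :: "complex^'m" and h :: "real^'m" and f e\<^sub>B :: "real^'m^'m"
  assumes f: "det f \<noteq> 0" and "\<sigma> \<noteq> 0"
    and c\<^sub>h: "c\<^sub>h = c - row_times d (matrix_inv f *v h)"
    and z0: "z0 \<in> mat_spectrum (darcy_symbol a c\<^sub>h \<kappa> A\<^sub>0 \<sigma>)" "Re z0 > 0"
  shows "\<forall>\<^sub>F \<epsilon> in at 0. \<exists>z\<in>mat_spectrum (full_symbol a c d g h f e\<^sub>B \<kappa> A\<^sub>0 \<epsilon> \<sigma>). Re z > 0"
proof -
  let ?M = "\<lambda>\<epsilon>. full_symbol a c d g h f e\<^sub>B \<kappa> A\<^sub>0 \<epsilon> \<sigma>"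
  let ?D = "darcy_symbol a c\<^sub>h \<kappa> A\<^sub>0 \<sigma>"
  define p where "p = matrix_inv f *v h"
  \<comment> \<open>For \<epsilon> \<noteq> 0 the symbol splits as
    \<open>X + Y / \<epsilon>\<close>. Setting \<open>h\<close> and \<open>f\<close> to zero removes
    every singular term, so the value 1 of the small parameter in \<open>X\<close> is
    immaterial.\<close>
  define X where "X = full_symbol a c d g 0 0 e\<^sub>B \<kappa> A\<^sub>0 1 \<sigma>"
  define Y :: "complex^(2 + 'm)^(2 + 'm)" where "Y = (\<chi> i j. case i of Inl _ \<Rightarrow> 0 | Inr k \<Rightarrow>
      \<i> * complex_of_real \<sigma> * (case j of
        Inl l \<Rightarrow> complex_of_real (if l = 1 then 2 * A\<^sub>0 * h $ k else 0)
      | Inr j' \<Rightarrow> complex_of_real (f $ k $ j')))"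
  \<comment> \<open>Row scaling: \<open>K\<close> is the symbol with its \<open>B\<close>-rows
    multiplied by \<epsilon>, written without division so that its value at 0 is the true limit.
    \<open>L\<close> is the scaling matrix itself, singular at 0.\<close>
  define s :: "real \<Rightarrow> 2 + 'm \<Rightarrow> complex"
    where "s \<epsilon> i = (case i of Inl _ \<Rightarrow> 1 | Inr _ \<Rightarrow> complex_of_real \<epsilon>)" for \<epsilon> i
  define K where "K \<epsilon> = (\<chi> i j. s \<epsilon> i * X $ i $ j + Y $ i $ j)" for \<epsilon>
  define L :: "real \<Rightarrow> complex^(2 + 'm)^(2 + 'm)" where "L \<epsilon> = (\<chi> i j. if i = j then s \<epsilon> i else 0)" for \<epsilon>
  have L: "(L \<epsilon> *v v) $ i = s \<epsilon> i * v $ i" for \<epsilon> v i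
    by (simp add: L_def matrix_vector_mult_def if_distrib[of "\<lambda>x. x * _"] cong: if_cong)
  have scaled: "K \<epsilon> $ i $ j = s \<epsilon> i * ?M \<epsilon> $ i $ j" if "\<epsilon> \<noteq> 0" for \<epsilon> i j
  proof (cases i)
    case (Inl i')
    then show ?thesis
      by (cases j) (auto simp: K_def X_def Y_def s_def full_symbol_def fourier_symbol_def block_matrix_def)
  next
    case (Inr k)
    show ?thesis
    proof (cases j)
      case (Inl l)
      then show ?thesis
        using exhaust_2[of l] \<open>\<epsilon> \<noteq> 0\<close> Inr
        by (auto simp: K_def X_def Y_def s_def full_symbol_def fourier_symbol_def block_matrix_def field_simps)
    next
      case (Inr j')
      then show ?thesis
        using \<open>i = Inr k\<close> \<open>\<epsilon> \<noteq> 0\<close>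
        by (auto simp: K_def X_def Y_def s_def full_symbol_def fourier_symbol_def block_matrix_def field_simps)
    qed
  qed
  have full: "?M \<epsilon> *v v = z *s v" if "\<epsilon> \<noteq> 0" "K \<epsilon> *v v = z *s (L \<epsilon> *v v)" for \<epsilon> v z
  proof -
    have "s \<epsilon> i * (?M \<epsilon> *v v) $ i = s \<epsilon> i * (z * v $ i)" for i
    proof -
      have "s \<epsilon> i * (?M \<epsilon> *v v) $ i = (K \<epsilon> *v v) $ i"
        using that(1) by (simp add: matrix_vector_mult_def scaled sum_distrib_left mult.assoc)
      then show ?thesis
        by (simp add: that(2) L mult.left_commute)
    qed
    moreover have "s \<epsilon> i \<noteq> 0" for i
      using that(1) by (cases i) (auto simp: s_def)
    ultimately show ?thesis
      by (simp add: vec_eq_iff)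
  qed
  have slow_row: "(K 0 *v v) $ Inr k = \<i> * complex_of_real \<sigma> *
      ((\<Sum>j\<in>UNIV. complex_of_real (f $ k $ j) * v $ Inr j) + 2 * A\<^sub>0 * v $ Inl 1 * h $ k)" for v k
    by (simp add: matrix_vector_mult_def sum_UNIV_Plus sum_2 K_def s_def Y_def algebra_simps sum_distrib_left)
  \<comment> \<open>Since \<sigma> \<noteq> 0, the common factor of the \<open>B\<close>-rows
    cancels.\<close>
  have slow: "(\<forall>k. (K 0 *v v) $ Inr k = 0) \<longleftrightarrow> (\<forall>j. v $ Inr j = - (2 * A\<^sub>0 * v $ Inl 1) * p $ j)" for v
    using complexified_system_iff[OF f, of "\<chi> j. v $ Inr j" "- (2 * A\<^sub>0 * v $ Inl 1)" h] \<open>\<sigma> \<noteq> 0\<close>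
    by (simp add: slow_row p_def eq_neg_iff_add_eq_0)
  \<comment> \<open>Inserting the solved \<open>w\<close> into the coupling through \<open>d\<close>
    adds a multiple of \<open>v $ Inl 1\<close>, which is exactly the shift from \<open>c\<close> to
    \<open>c\<^sub>h\<close> in the first column of the Darcy symbol.\<close>
  have fast: "(K 0 *v v) $ Inl i = (?D *v (\<chi> l. v $ Inl l)) $ i"
    if "\<And>j. v $ Inr j = - (2 * A\<^sub>0 * v $ Inl 1) * p $ j" for v i
  proof -
    have row_sum: "(\<Sum>j\<in>UNIV. complex_of_real (r j) * v $ Inr j)
        = - (2 * A\<^sub>0 * v $ Inl 1) * complex_of_real (\<Sum>j\<in>UNIV. r j * p $ j)" for r
      by (simp add: that sum_distrib_left sum_negf mult.left_commute mult.assoc)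
    have reim: "Re c\<^sub>h = Re c - (\<Sum>j\<in>UNIV. Re (d $ j) * p $ j)"
      "Im c\<^sub>h = Im c - (\<Sum>j\<in>UNIV. Im (d $ j) * p $ j)"
      by (simp_all add: c\<^sub>h row_times_def p_def)
    have "(K 0 *v v) $ Inl i = X $ Inl i $ Inl 1 * v $ Inl 1 + X $ Inl i $ Inl 2 * v $ Inl 2
        + (\<Sum>j\<in>UNIV. X $ Inl i $ Inr j * v $ Inr j)"
      by (simp add: matrix_vector_mult_def sum_UNIV_Plus sum_2 K_def s_def Y_def)
    also have "(\<Sum>j\<in>UNIV. X $ Inl i $ Inr j * v $ Inr j) = (\<Sum>j\<in>UNIV.
        complex_of_real (A\<^sub>0 * (if i = 1 then Re (d $ j) else Im (d $ j))) * v $ Inr j)"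
      using exhaust_2[of i]
      by (auto simp: X_def full_symbol_def fourier_symbol_def block_matrix_def intro!: sum.cong)
    also have "\<dots> = - (2 * A\<^sub>0\<^sup>2 * v $ Inl 1) *
        complex_of_real (\<Sum>j\<in>UNIV. (if i = 1 then Re (d $ j) else Im (d $ j)) * p $ j)"
      unfolding row_sum by (simp add: sum_distrib_left power2_eq_square mult_ac)
    finally show ?thesis
      using exhaust_2[of i]
      by (auto simp: X_def full_symbol_def darcy_symbol_def fourier_symbol_def block_matrix_def mat22_def
          matrix_vector_mult_def sum_2 reim algebra_simps)
  qed
  have limit: "K 0 *v v = z *s (L 0 *v v) \<longleftrightarrow>
      (\<forall>j. v $ Inr j = - (2 * A\<^sub>0 * v $ Inl 1) * p $ j) \<and> ?D *v (\<chi> l. v $ Inl l) = z *s (\<chi> l. v $ Inl l)"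
    for v z
  proof -
    \<comment> \<open>\<open>L 0\<close> vanishes on the \<open>B\<close>-rows, so \<open>z\<close>
      appears only in the two amplitude rows.\<close>
    have "K 0 *v v = z *s (L 0 *v v) \<longleftrightarrow>
        (\<forall>k. (K 0 *v v) $ Inr k = 0) \<and> (\<forall>i. (K 0 *v v) $ Inl i = z * v $ Inl i)"
      by (auto simp: vec_eq_iff L s_def split: sum.split)
    then show ?thesis
      using fast[of v] by (auto simp: slow vec_eq_iff)
  qed
  obtain u where u: "u \<noteq> 0" "?D *v u = z0 *s u"
    using z0 by (auto simp: mat_spectrum_def)
  \<comment> \<open>The Darcy eigenvector, completed by the \<open>w\<close> that the limiting
    \<open>B\<close>-rows prescribe.\<close>
  define v0 :: "complex^(2 + 'm)" where
    "v0 = (\<chi> i. case i of Inl l \<Rightarrow> u $ l | Inr j \<Rightarrow> - (2 * A\<^sub>0 * u $ 1) * p $ j)"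
  have v0: "(\<chi> l. v0 $ Inl l) = u" "v0 $ Inr j = - (2 * A\<^sub>0 * v0 $ Inl 1) * p $ j" for j
    by (simp_all add: v0_def vec_eq_iff)
  obtain z1 where z1: "Re z1 > 0" "z1 \<notin> mat_spectrum ?D"
    by (rule exists_positive_non_eigenvalue)
  have "\<forall>\<^sub>F \<epsilon> in at 0. \<exists>z\<in>{z. Re z > 0}. \<exists>v. v \<noteq> 0 \<and> K \<epsilon> *v v = z *s (L \<epsilon> *v v)"
  proof (rule generalized_eigenvalue_persists[where ?z0.0 = z0 and ?z1.0 = z1 and v = v0])
    have cs: "continuous_on UNIV (\<lambda>\<epsilon>. s \<epsilon> i)" for i
      by (cases i) (auto simp: s_def intro!: continuous_intros)
    show "continuous_on UNIV K"
      unfolding K_def by (intro continuous_intros cs)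
    have "continuous_on UNIV (\<lambda>\<epsilon>. if i = j then s \<epsilon> i else 0)" for i j
      by (cases "i = j") (auto intro: cs)
    then show "continuous_on UNIV L"
      unfolding L_def by (intro continuous_intros)
    show "v0 \<noteq> 0"
      using u(1) v0(1) by (metis vec_eq_iff vec_lambda_beta zero_index)
    show "K 0 *v v0 = z0 *s (L 0 *v v0)"
      unfolding limit v0(1) using u v0(2) by blast
    \<comment> \<open>As \<open>z1\<close> is not a Darcy eigenvalue, the amplitude part is zero;
      \<open>w\<close> is a multiple of its first entry and vanishes too.\<close>
    show "v = 0" if "K 0 *v v = z1 *s (L 0 *v v)" for v
    proof -
      have red: "(\<chi> l. v $ Inl l) = 0" "\<And>j. v $ Inr j = - (2 * A\<^sub>0 * v $ Inl 1) * p $ j"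
        using that z1(2) unfolding limit mat_spectrum_def by auto
      have fst0: "v $ Inl l = 0" for l
        using red(1) by (simp add: vec_eq_iff)
      have "v $ i = 0" for i
        by (cases i) (simp_all add: fst0 red(2))
      then show ?thesis by (simp add: vec_eq_iff)
    qed
  qed (use z0 z1 open_connected_right_half_plane in auto)
  moreover have "\<forall>\<^sub>F \<epsilon> in at (0::real). \<epsilon> \<noteq> 0"
    by (simp add: eventually_at_filter)
  ultimately show ?thesis
  proof eventually_elim
    case (elim \<epsilon>)
    then obtain z v where "Re z > 0" "v \<noteq> 0" "?M \<epsilon> *v v = z *s v"
      using full by blast
    then show ?case
      unfolding mat_spectrum_def by blast
  qed
qed

theorem corollary3p2:
  fixes a b c b\<^sub>t b\<^sub>h c\<^sub>h :: complex
    and d g :: "complex^'m"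
    and h B\<^sub>0 :: "real^'m"
    and f e\<^sub>B :: "real^'m^'m"
    and \<kappa> \<omega> A\<^sub>0 q\<^sub>h \<mu> :: real
  assumes "Re a > 0" and "Re b > 0" and "Re c < 0"
    and "mat_spectrum (map_matrix complex_of_real f) \<subseteq> \<real>"
    and "\<forall>z\<in>mat_spectrum (map_matrix complex_of_real e\<^sub>B). Re z > 0"
    and "\<forall>s::real. s \<noteq> 0 \<longrightarrow> (\<forall>z\<in>mat_spectrum (fourier_symbol 0 f e\<^sub>B s). Re z < 0)"
    and "b\<^sub>t = b + row_times d B\<^sub>0"
    and "\<kappa>\<^sup>2 < Re b\<^sub>t / Re a"
    and "A\<^sub>0 > 0" and "A\<^sub>0\<^sup>2 = (Re b\<^sub>t - \<kappa>\<^sup>2 * Re a) / (- Re c)"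
    and "det f \<noteq> 0"
    and "b\<^sub>h = b + row_times d (B\<^sub>0 + A\<^sub>0\<^sup>2 *\<^sub>R (matrix_inv f *v h))"
    and "c\<^sub>h = c - row_times d (matrix_inv f *v h)"
    and "\<forall>\<epsilon>>0. amplitude_solution a b c d g h f e\<^sub>B \<epsilon> (plane_wave A\<^sub>0 \<kappa> \<omega>) (\<lambda>x t. B\<^sub>0)"
    and "darcy_solution a b\<^sub>h c\<^sub>h (plane_wave A\<^sub>0 \<kappa> \<omega>)"
    and "Re c\<^sub>h \<noteq> 0"
    and "q\<^sub>h = - Im c\<^sub>h / Re c\<^sub>h"
    and "\<mu> = - (2 * \<kappa>\<^sup>2 * (Re a)\<^sup>2 * (1 + q\<^sub>h\<^sup>2) + A\<^sub>0\<^sup>2 * (Re a * Re c\<^sub>h + Im a * Im c\<^sub>h))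
               / (A\<^sub>0\<^sup>2 * Re c\<^sub>h)"
    and "\<mu> \<noteq> 0"
  shows "\<exists>\<epsilon>\<^sub>0>0. \<forall>\<epsilon>. 0 < \<epsilon> \<and> \<epsilon> < \<epsilon>\<^sub>0 \<longrightarrow>
           spectrally_stable (full_symbol a c d g h f e\<^sub>B \<kappa> A\<^sub>0 \<epsilon>) \<longrightarrow>
           spectrally_stable (darcy_symbol a c\<^sub>h \<kappa> A\<^sub>0)"
proof (cases "spectrally_stable (darcy_symbol a c\<^sub>h \<kappa> A\<^sub>0)")
  case True
  then show ?thesis by (intro exI[of _ 1]) simp
next
  case False
  \<comment> \<open>The unstable frequency is fixed before \<epsilon> is chosen. Instability at this
    single frequency destabilizes the full system, so \<open>\<epsilon>\<^sub>0\<close> may depend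
    on it.\<close>
  then obtain \<sigma> z where \<sigma>: "\<sigma> \<noteq> 0" "z \<in> mat_spectrum (darcy_symbol a c\<^sub>h \<kappa> A\<^sub>0 \<sigma>)" "Re z > 0"
    unfolding darcy_symbol_def[abs_def] by (rule unstable_frequency_nonzero)
  have "\<forall>\<^sub>F \<epsilon> in at 0. \<exists>z\<in>mat_spectrum (full_symbol a c d g h f e\<^sub>B \<kappa> A\<^sub>0 \<epsilon> \<sigma>). Re z > 0"
    by (rule unstable_darcy_imp_unstable_full[OF \<open>det f \<noteq> 0\<close> \<sigma>(1)
          \<open>c\<^sub>h = c - row_times d (matrix_inv f *v h)\<close> \<sigma>(2,3)])
  then obtain \<epsilon>\<^sub>0 where "\<epsilon>\<^sub>0 > 0" and unstable: "\<And>\<epsilon>. \<epsilon> \<noteq> 0 \<Longrightarrow> \<bar>\<epsilon>\<bar> < \<epsilon>\<^sub>0 \<Longrightarrow>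
      \<exists>z\<in>mat_spectrum (full_symbol a c d g h f e\<^sub>B \<kappa> A\<^sub>0 \<epsilon> \<sigma>). Re z > 0"
    by (auto simp: eventually_at)
  have "\<not> spectrally_stable (full_symbol a c d g h f e\<^sub>B \<kappa> A\<^sub>0 \<epsilon>)" if "0 < \<epsilon>" "\<epsilon> < \<epsilon>\<^sub>0" for \<epsilon>
    using unstable[of \<epsilon>] that by (force simp: spectrally_stable_def not_le)
  with \<open>\<epsilon>\<^sub>0 > 0\<close> show ?thesis by blast
qed

end
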